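(* Let $H$ and $H_1,\dots,H_m$ be finite-dimensional Hilbert spaces, let $\{V_j\}_{j=1}^m$, $V_j\in B(H,H_j)$, be an (OPV)-frame for $H$ robust to $k$ erasures, and let $P$ be an orthogonal projection on $H$. Then $\{V_jP\}_{j=1}^m$ is an (OPV)-frame for $P(H)$ robust to $k$ erasures.
   Context: Hilbert spaces are over $\mathbb{R}$ or $\mathbb{C}$. A finite family $V_j\in B(H,H_j)$, $j\in J$, is an operator-valued frame ((OPV)-frame) for $H$ if there are constants $A,B>0$ with $AI\le\sum_{j\in J} V_j^*V_j\le BI$. An (OPV)-frame $\{V_j\}_{j=1}^m$ is robust to $k$ erasures if for every $I\subseteq\{1,\dots,m\}$ with $|I|=k$ the family $\{V_j\}_{j\in I^c}$ is still an (OPV)-frame for the same space, where $I^c=\{1,\dots,m\}\setminus I$. The operators $V_jP$ are regarded as operators from $P(H)$ to $H_j$. *)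

theory Defs
  imports "HOL-Analysis.Analysis" "Jordan_Normal_Form.Conjugate"
begin

(* The scalars are the reals or the complex numbers. The last axiom determines both the
   conjugation and the scalars: applied to x and to x + 1 it shows that x * conjugate x and
   x + conjugate x are real, so every scalar is a root of a real quadratic polynomial, and
   hence real and complex are the only instances up to isomorphism. *)
class real_or_complex = real_normed_field + conjugatable_field +
  assumes mult_conjugate: "x * conjugate x = (norm x)\<^sup>2 *\<^sub>R 1"

instance real :: real_or_complex
  by standard (simp add: power2_eq_square)

instance complex :: real_or_complex
  by standard (simp add: complex_norm_square scaleR_conv_of_real flip: of_real_power)

(* A Hilbert space is a subspace vecs of an ambient vector space, with an inner product that
   matters on vecs only. The spaces H_j of a finite family may differ in all three components;
   sharing the ambient type costs no generality, as they all embed in their direct sum. *)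
record ('k, 'a) hilb =
  smul :: "'k \<Rightarrow> 'a \<Rightarrow> 'a"
  vecs :: "'a set"
  ip :: "'a \<Rightarrow> 'a \<Rightarrow> 'k"

definition hnorm :: "('k::real_or_complex, 'a) hilb \<Rightarrow> 'a \<Rightarrow> real" where
  "hnorm H x = sqrt (norm (ip H x x))"

definition nonneg_scalars :: "'k::real_or_complex set" where
  "nonneg_scalars = of_real ` {0..}"

locale inner_product_space = vector_space "smul H"
  for H :: "('k::real_or_complex, 'a::ab_group_add) hilb" +
  assumes subspace_vecs: "subspace (vecs H)"
    and ip_add: "\<lbrakk>x \<in> vecs H; y \<in> vecs H; z \<in> vecs H\<rbrakk> \<Longrightarrow> ip H (x + y) z = ip H x z + ip H y z"
    and ip_smul: "\<lbrakk>x \<in> vecs H; y \<in> vecs H\<rbrakk> \<Longrightarrow> ip H (smul H c x) y = c * ip H x y"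
    and ip_conjugate: "\<lbrakk>x \<in> vecs H; y \<in> vecs H\<rbrakk> \<Longrightarrow> ip H y x = conjugate (ip H x y)"
    and ip_nonneg: "x \<in> vecs H \<Longrightarrow> ip H x x \<in> nonneg_scalars"
    and ip_definite: "\<lbrakk>x \<in> vecs H; ip H x x = 0\<rbrakk> \<Longrightarrow> x = 0"

locale hilbert_space = inner_product_space +
  assumes complete:
    "\<lbrakk>\<And>n. X n \<in> vecs H;
      \<And>e. e > 0 \<Longrightarrow> \<exists>N. \<forall>m\<ge>N. \<forall>n\<ge>N. hnorm H (X m - X n) < e\<rbrakk>
     \<Longrightarrow> \<exists>l\<in>vecs H. (\<lambda>n. hnorm H (X n - l)) \<longlonglongrightarrow> 0"

definition finite_dimensional :: "('k::real_or_complex, 'a::ab_group_add) hilb \<Rightarrow> bool" where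
  "finite_dimensional H \<longleftrightarrow> (\<exists>B. finite B \<and> module.span (smul H) B = vecs H)"

definition bounded_operator ::
  "('k::real_or_complex, 'a::ab_group_add) hilb \<Rightarrow> ('k, 'b::ab_group_add) hilb \<Rightarrow> ('a \<Rightarrow> 'b) \<Rightarrow> bool"
where
  "bounded_operator H K T \<longleftrightarrow>
     T ` vecs H \<subseteq> vecs K \<and>
     (\<forall>x\<in>vecs H. \<forall>y\<in>vecs H. T (x + y) = T x + T y) \<and>
     (\<forall>c. \<forall>x\<in>vecs H. T (smul H c x) = smul K c (T x)) \<and>
     (\<exists>C. \<forall>x\<in>vecs H. hnorm K (T x) \<le> C * hnorm H x)"

definition hilbert_adjoint ::
  "('k::real_or_complex, 'a) hilb \<Rightarrow> ('k, 'b) hilb \<Rightarrow> ('a \<Rightarrow> 'b) \<Rightarrow> 'b \<Rightarrow> 'a"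
where
  "hilbert_adjoint H K T y = (THE z. z \<in> vecs H \<and> (\<forall>x\<in>vecs H. ip K (T x) y = ip H x z))"

definition operator_le ::
  "('k::real_or_complex, 'a::ab_group_add) hilb \<Rightarrow> ('a \<Rightarrow> 'a) \<Rightarrow> ('a \<Rightarrow> 'a) \<Rightarrow> bool"
where
  "operator_le H S T \<longleftrightarrow> (\<forall>x\<in>vecs H. ip H (T x - S x) x \<in> nonneg_scalars)"

definition frame_operator ::
  "('k::real_or_complex, 'a::ab_group_add) hilb \<Rightarrow> ('j \<Rightarrow> ('k, 'b::ab_group_add) hilb)
   \<Rightarrow> ('j \<Rightarrow> 'a \<Rightarrow> 'b) \<Rightarrow> 'j set \<Rightarrow> 'a \<Rightarrow> 'a"
where
  "frame_operator H K V J x = (\<Sum>j\<in>J. hilbert_adjoint H (K j) (V j) (V j x))"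

definition opv_frame ::
  "('k::real_or_complex, 'a::ab_group_add) hilb \<Rightarrow> ('j \<Rightarrow> ('k, 'b::ab_group_add) hilb)
   \<Rightarrow> ('j \<Rightarrow> 'a \<Rightarrow> 'b) \<Rightarrow> 'j set \<Rightarrow> bool"
where
  "opv_frame H K V J \<longleftrightarrow>
     finite J \<and> hilbert_space H \<and>
     (\<forall>j\<in>J. hilbert_space (K j) \<and> bounded_operator H (K j) (V j)) \<and>
     (\<exists>A>0. \<exists>B>0.
        operator_le H (smul H (of_real A)) (frame_operator H K V J) \<and>
        operator_le H (frame_operator H K V J) (smul H (of_real B)))"

definition opv_frame_robust ::
  "('k::real_or_complex, 'a::ab_group_add) hilb \<Rightarrow> (nat \<Rightarrow> ('k, 'b::ab_group_add) hilb)
   \<Rightarrow> (nat \<Rightarrow> 'a \<Rightarrow> 'b) \<Rightarrow> nat \<Rightarrow> nat \<Rightarrow> bool"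
where
  "opv_frame_robust H K V m k \<longleftrightarrow>
     opv_frame H K V {1..m} \<and>
     (\<forall>I. I \<subseteq> {1..m} \<and> card I = k \<longrightarrow> opv_frame H K V ({1..m} - I))"

definition orthogonal_projection ::
  "('k::real_or_complex, 'a::ab_group_add) hilb \<Rightarrow> ('a \<Rightarrow> 'a) \<Rightarrow> bool"
where
  "orthogonal_projection H P \<longleftrightarrow>
     bounded_operator H H P \<and>
     (\<forall>x\<in>vecs H. P (P x) = P x) \<and>
     (\<forall>x\<in>vecs H. \<forall>y\<in>vecs H. ip H (P x) y = ip H x (P y))"

(* P(H) with the structure inherited from H. *)
definition range_space :: "('k, 'a) hilb \<Rightarrow> ('a \<Rightarrow> 'a) \<Rightarrow> ('k, 'a) hilb" where
  "range_space H P = H\<lparr>vecs := P ` vecs H\<rparr>"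

end

theory Submission
  imports Defs
begin

(* On P(H) the adjoint of V_j P is P V_j^*, so the frame operator of the compressed family is the
   compression P S of the frame operator S. For x in P(H) we have <P S x, x> = <S x, x>, and both
   frame inequalities carry over to every subfamily with the same constants. The adjoints exist by
   the Riesz representation theorem. *)

section \<open>Inner product calculus, Riesz representation and adjoints\<close>

context inner_product_space
begin

lemma zero_mem: "0 \<in> vecs H"
  and add_mem: "x \<in> vecs H \<Longrightarrow> y \<in> vecs H \<Longrightarrow> x + y \<in> vecs H"
  and diff_mem: "x \<in> vecs H \<Longrightarrow> y \<in> vecs H \<Longrightarrow> x - y \<in> vecs H"
  and smul_mem: "x \<in> vecs H \<Longrightarrow> smul H c x \<in> vecs H"
  using subspace_vecs by (auto intro: subspace_0 subspace_add subspace_diff subspace_scale)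

lemma ip_diff:
  assumes "x \<in> vecs H" "y \<in> vecs H" "z \<in> vecs H"
  shows "ip H (x - y) z = ip H x z - ip H y z"
  using ip_add[of "x - y" y z] assms by (simp add: diff_mem)

lemma ip_add_right:
  assumes "x \<in> vecs H" "y \<in> vecs H" "z \<in> vecs H"
  shows "ip H x (y + z) = ip H x y + ip H x z"
  using assms ip_conjugate[of _ x] by (simp add: add_mem ip_add conjugate_dist_add)

lemma ip_diff_right:
  assumes "x \<in> vecs H" "y \<in> vecs H" "z \<in> vecs H"
  shows "ip H x (y - z) = ip H x y - ip H x z"
  using ip_add_right[of x "y - z" z] assms by (simp add: diff_mem)

lemma ip_smul_right:
  assumes "x \<in> vecs H" "y \<in> vecs H"
  shows "ip H x (smul H c y) = conjugate c * ip H x y"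
  using assms ip_conjugate[of _ x] by (simp add: smul_mem ip_smul conjugate_dist_mul)

text \<open>Testing with \<open>x = y - z\<close> makes the difference orthogonal to itself. This is
  the uniqueness behind the definite description in \<open>hilbert_adjoint\<close>.\<close>

lemma eq_if_ip_eq:
  assumes "y \<in> vecs H" "z \<in> vecs H" and "\<And>x. x \<in> vecs H \<Longrightarrow> ip H x y = ip H x z"
  shows "y = z"
  using assms ip_definite[of "y - z"] by (simp add: diff_mem ip_diff_right)

text \<open>Gram-Schmidt, one generator at a time: a new \<open>b\<close> is replaced by its
  component \<open>b'\<close> orthogonal to \<open>span B\<close>, and the representing vector is
  corrected along \<open>b'\<close> only. Since \<open>b'\<close> may vanish, \<open>B\<close> can
  be any finite spanning set.\<close>

lemma riesz_span:
  assumes "finite B" "B \<subseteq> vecs H"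
    and "\<And>x y. x \<in> vecs H \<Longrightarrow> y \<in> vecs H \<Longrightarrow> f (x + y) = f x + f y"
    and "\<And>c x. x \<in> vecs H \<Longrightarrow> f (smul H c x) = c * f x"
  shows "\<exists>z\<in>span B. \<forall>x\<in>span B. f x = ip H x z"
  using assms
proof (induction B arbitrary: f rule: finite_induct)
  case empty
  have "f 0 = 0"
    using empty(3)[of 0 0] zero_mem by (metis empty(2) add.right_neutral add_left_cancel)
  moreover have "ip H 0 0 = 0"
    using ip_add[of 0 0 0] zero_mem by simp
  ultimately show ?case by simp
next
  case (insert b B)
  have B: "B \<subseteq> vecs H" and b: "b \<in> vecs H" using insert.prems by auto
  have sub: "span B \<subseteq> vecs H" using B subspace_vecs by (rule span_minimal)
  \<comment> \<open>The representing vector \<open>p\<close> of the functional given by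
    \<open>b\<close> is the orthogonal projection of \<open>b\<close> onto \<open>span B\<close>.
    The induction hypothesis is used for this functional as well as for \<open>f\<close>, hence the
    generalization over \<open>f\<close>.\<close>
  obtain p where p: "p \<in> span B" "\<And>x. x \<in> span B \<Longrightarrow> ip H x b = ip H x p"
    using insert.IH[of "\<lambda>x. ip H x b"] B b ip_add ip_smul by auto
  obtain z where z: "z \<in> span B" "\<And>x. x \<in> span B \<Longrightarrow> f x = ip H x z"
    using insert.IH[of f] B insert.prems by auto
  define b' where "b' = b - p"
  have b': "b' \<in> vecs H" using b p sub by (auto simp: b'_def intro: diff_mem)
  have orth: "ip H x b' = 0" if "x \<in> span B" for x
    using that b p sub by (auto simp: b'_def ip_diff_right subset_iff)
  have orth': "ip H b' x = 0" if "x \<in> span B" for x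
    using ip_conjugate[of x b'] orth[OF that] that b' sub by auto
  \<comment> \<open>Trading \<open>b\<close> for \<open>b'\<close> changes the remainder by a
    multiple of \<open>p\<close>, which stays in \<open>span B\<close>.\<close>
  have decomp: "\<exists>s\<in>span B. \<exists>c. x = s + smul H c b'" if x: "x \<in> span (insert b B)" for x
  proof -
    obtain c where c: "x - smul H c b \<in> span B"
      using x by (auto simp: span_insert)
    have "(x - smul H c b) + smul H c p \<in> span B"
      using c p by (simp add: span_add span_scale)
    moreover have "x = ((x - smul H c b) + smul H c p) + smul H c b'"
      by (simp add: b'_def scale_right_diff_distrib)
    ultimately show ?thesis by blast
  qed
  \<comment> \<open>The coefficient is forced by requiring the inner product of \<open>b'\<close>
    with \<open>w\<close> to be \<open>f b'\<close>; the conjugate appears because the second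
    argument is conjugate-linear. If \<open>b' = 0\<close>, then \<open>f b' = 0\<close> and so
    \<open>d = 0\<close>.\<close>
  define d where "d = conjugate (f b' / ip H b' b')"
  define w where "w = z + smul H d b'"
  have "b \<in> span (insert b B)" by (simp add: span_base)
  moreover have mono: "span B \<subseteq> span (insert b B)" by (rule span_mono) auto
  ultimately have "b' \<in> span (insert b B)" using p by (auto simp: b'_def intro: span_diff)
  hence w: "w \<in> span (insert b B)" using z mono by (auto simp: w_def intro: span_add span_scale)
  have fb': "conjugate d * ip H b' b' = f b'"
  proof (cases "b' = 0")
    case True
    hence "f b' = 0" using insert.prems(3)[of b' 0] b' by simp
    thus ?thesis by (simp add: d_def)
  next
    case False
    hence "ip H b' b' \<noteq> 0" using ip_definite b' by blast
    thus ?thesis by (simp add: d_def)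
  qed
  have "f x = ip H x w" if x: "x \<in> span (insert b B)" for x
  proof -
    obtain s c where s: "s \<in> span B" and xs: "x = s + smul H c b'" using decomp[OF x] by blast
    have mem: "s \<in> vecs H" "z \<in> vecs H" using s z sub by auto
    have "f x = ip H s z + c * f b'"
      using insert.prems mem b' s z by (simp add: xs smul_mem)
    moreover have "ip H x w = ip H s z + c * (conjugate d * ip H b' b')"
      using mem b' orth[OF s] orth'[OF z(1)]
      by (simp add: xs w_def ip_add ip_smul ip_add_right ip_smul_right smul_mem add_mem)
    ultimately show ?thesis by (simp add: fb')
  qed
  thus ?case using w by blast
qed

lemma riesz_representation:
  assumes "finite_dimensional H"
    and "\<And>x y. x \<in> vecs H \<Longrightarrow> y \<in> vecs H \<Longrightarrow> f (x + y) = f x + f y"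
    and "\<And>c x. x \<in> vecs H \<Longrightarrow> f (smul H c x) = c * f x"
  shows "\<exists>z\<in>vecs H. \<forall>x\<in>vecs H. f x = ip H x z"
proof -
  obtain B where "finite B" "span B = vecs H"
    using assms(1) by (auto simp: finite_dimensional_def)
  thus ?thesis using riesz_span[of B f] assms(2,3) span_superset[of B] by auto
qed

lemma hilbert_adjoint_eqI:
  assumes "z \<in> vecs H" and "\<And>x. x \<in> vecs H \<Longrightarrow> ip K (T x) y = ip H x z"
  shows "hilbert_adjoint H K T y = z"
  unfolding hilbert_adjoint_def using assms by (auto intro!: the_equality intro: eq_if_ip_eq)

text \<open>For fixed \<open>y\<close>, the inner product of \<open>T x\<close> with
  \<open>y\<close> is linear in \<open>x\<close>, so Riesz supplies the vector that the definite
  description asks for.\<close>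

lemma hilbert_adjoint:
  assumes "finite_dimensional H" "inner_product_space K" "bounded_operator H K T" "y \<in> vecs K"
  shows "hilbert_adjoint H K T y \<in> vecs H"
    and "x \<in> vecs H \<Longrightarrow> ip K (T x) y = ip H x (hilbert_adjoint H K T y)"
proof -
  interpret K: inner_product_space K by fact
  have "\<exists>z\<in>vecs H. \<forall>x\<in>vecs H. ip K (T x) y = ip H x z"
    using assms(3,4)
    by (intro riesz_representation[OF assms(1)])
       (auto simp: bounded_operator_def image_subset_iff K.ip_add K.ip_smul)
  then obtain z where "z \<in> vecs H" "\<And>x. x \<in> vecs H \<Longrightarrow> ip K (T x) y = ip H x z" by blast
  thus "hilbert_adjoint H K T y \<in> vecs H"
    and "x \<in> vecs H \<Longrightarrow> ip K (T x) y = ip H x (hilbert_adjoint H K T y)"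
    using hilbert_adjoint_eqI[of z K T y] by auto
qed

end

section \<open>The range of the projection and the compressed operators\<close>

lemma range_space_simps [simp]:
  "smul (range_space H P) = smul H" "vecs (range_space H P) = P ` vecs H"
  "ip (range_space H P) = ip H" "hnorm (range_space H P) = hnorm H"
  by (auto simp: range_space_def hnorm_def fun_eq_iff)

locale projected_space = hilbert_space H
  for H :: "('k::real_or_complex, 'a::ab_group_add) hilb" +
  fixes P :: "'a \<Rightarrow> 'a"
  assumes projection: "orthogonal_projection H P"
begin

lemma P_mem: "x \<in> vecs H \<Longrightarrow> P x \<in> vecs H"
  and P_add: "x \<in> vecs H \<Longrightarrow> y \<in> vecs H \<Longrightarrow> P (x + y) = P x + P y"
  and P_smul: "x \<in> vecs H \<Longrightarrow> P (smul H c x) = smul H c (P x)"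
  and P_idem: "x \<in> vecs H \<Longrightarrow> P (P x) = P x"
  and P_sym: "x \<in> vecs H \<Longrightarrow> y \<in> vecs H \<Longrightarrow> ip H (P x) y = ip H x (P y)"
  and P_bounded: "\<exists>C. \<forall>x\<in>vecs H. hnorm H (P x) \<le> C * hnorm H x"
  using projection by (auto simp: orthogonal_projection_def bounded_operator_def)

lemma P_diff: "x \<in> vecs H \<Longrightarrow> y \<in> vecs H \<Longrightarrow> P (x - y) = P x - P y"
  using P_add[of "x - y" y] by (simp add: diff_mem)

lemma P_zero: "P 0 = 0"
  using P_add[of 0 0] zero_mem by simp

lemma P_sum:
  assumes "\<And>j. j \<in> J \<Longrightarrow> g j \<in> vecs H"
  shows "P (\<Sum>j\<in>J. g j) = (\<Sum>j\<in>J. P (g j))"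
  using assms
proof (induction J rule: infinite_finite_induct)
  case (insert j F)
  moreover have "sum g F \<in> vecs H"
    using insert.prems by (intro subspace_sum subspace_vecs) auto
  ultimately show ?case by (simp add: P_add)
qed (simp_all add: P_zero)

text \<open>Only completeness takes an argument: the limit \<open>l\<close> found in
  \<open>H\<close> is replaced by \<open>P l\<close>, which visibly lies in the range.\<close>

lemma hilbert_space_range: "hilbert_space (range_space H P)"
proof -
  have sub: "subspace (P ` vecs H)"
  proof (rule subspaceI)
    show "0 \<in> P ` vecs H" using P_zero zero_mem by (metis imageI)
    show "x + y \<in> P ` vecs H" if "x \<in> P ` vecs H" "y \<in> P ` vecs H" for x y
      using that by (auto simp: P_add[symmetric] add_mem)
    show "smul H c x \<in> P ` vecs H" if "x \<in> P ` vecs H" for c x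
      using that by (auto simp: P_smul[symmetric] smul_mem)
  qed
  have ips: "inner_product_space (range_space H P)"
    using vector_space_axioms sub
    by (auto simp: inner_product_space_def inner_product_space_axioms_def
        ip_add ip_smul ip_nonneg ip_definite P_mem intro: ip_conjugate)
  have "\<exists>l\<in>P ` vecs H. (\<lambda>n. hnorm H (X n - l)) \<longlonglongrightarrow> 0"
    if X: "\<And>n. X n \<in> P ` vecs H"
      and cauchy: "\<And>e. e > 0 \<Longrightarrow> \<exists>N. \<forall>m\<ge>N. \<forall>n\<ge>N. hnorm H (X m - X n) < e" for X
  proof -
    have XH: "X n \<in> vecs H" and PX: "P (X n) = X n" for n
      using X[of n] by (auto simp: P_mem P_idem)
    obtain l where l: "l \<in> vecs H" and lim: "(\<lambda>n. hnorm H (X n - l)) \<longlonglongrightarrow> 0"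
      using complete[OF XH cauchy] by blast
    obtain C where C: "\<And>x. x \<in> vecs H \<Longrightarrow> hnorm H (P x) \<le> C * hnorm H x"
      using P_bounded by blast
    \<comment> \<open>As \<open>P\<close> fixes each \<open>X n\<close>, the left-hand vector is
      \<open>P (X n - l)\<close>.\<close>
    have upper: "hnorm H (X n - P l) \<le> C * hnorm H (X n - l)" for n
      using C[of "X n - l"] by (simp add: P_diff XH l PX diff_mem)
    have "(\<lambda>n. hnorm H (X n - P l)) \<longlonglongrightarrow> 0"
    proof (rule tendsto_sandwich)
      show "\<forall>\<^sub>F n in sequentially. 0 \<le> hnorm H (X n - P l)" by (simp add: hnorm_def)
      show "\<forall>\<^sub>F n in sequentially. hnorm H (X n - P l) \<le> C * hnorm H (X n - l)"
        by (simp add: upper)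
      show "(\<lambda>n. C * hnorm H (X n - l)) \<longlonglongrightarrow> 0"
        using lim by (rule tendsto_mult_right_zero)
    qed simp
    thus ?thesis using l by blast
  qed
  thus ?thesis using ips by (simp add: hilbert_space_def hilbert_space_axioms_def)
qed

lemma bounded_operator_range:
  assumes "bounded_operator H K T"
  shows "bounded_operator (range_space H P) K (T \<circ> P)"
proof -
  obtain C where "\<And>x. x \<in> vecs H \<Longrightarrow> hnorm K (T x) \<le> C * hnorm H x"
    using assms unfolding bounded_operator_def by blast
  \<comment> \<open>\<open>P\<close> fixes the vectors of its range, so the bound \<open>C\<close>
    of \<open>T\<close> carries over unchanged.\<close>
  hence "\<forall>x\<in>P ` vecs H. hnorm K ((T \<circ> P) x) \<le> C * hnorm H x"
    by (auto simp: P_mem P_idem)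
  thus ?thesis
    using assms by (auto simp: bounded_operator_def P_add P_smul P_mem P_idem smul_mem add_mem
        image_subset_iff)
qed

text \<open>For \<open>x\<close> in the range, moving \<open>P\<close> across the inner product onto
  \<open>x\<close> makes it disappear, so compression leaves the quadratic form unchanged
  there.\<close>

lemma operator_le_range:
  assumes "operator_le H S T"
    and "\<And>x. x \<in> vecs H \<Longrightarrow> S x \<in> vecs H" "\<And>x. x \<in> vecs H \<Longrightarrow> T x \<in> vecs H"
    and "\<And>x. x \<in> P ` vecs H \<Longrightarrow> S' x = P (S x)" "\<And>x. x \<in> P ` vecs H \<Longrightarrow> T' x = P (T x)"
  shows "operator_le (range_space H P) S' T'"
  unfolding operator_le_def
proof
  fix x assume "x \<in> vecs (range_space H P)"
  hence x: "x \<in> P ` vecs H" by simp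
  hence xH: "x \<in> vecs H" and Px: "P x = x" by (auto simp: P_mem P_idem)
  have "ip H (T' x - S' x) x = ip H (P (T x - S x)) x"
    using assms x xH by (simp add: P_diff)
  also have "\<dots> = ip H (T x - S x) x"
    using assms xH by (simp add: P_sym Px diff_mem)
  finally show "ip (range_space H P) (T' x - S' x) x \<in> nonneg_scalars"
    using assms(1) xH by (simp add: operator_le_def)
qed

text \<open>Riesz is invoked in \<open>H\<close> only: self-adjointness of \<open>P\<close> shows
  that the projected adjoint satisfies the defining identity on the range, and uniqueness there does
  the rest.\<close>

lemma hilbert_adjoint_range:
  assumes "finite_dimensional H" "inner_product_space K" "bounded_operator H K T" "y \<in> vecs K"
  shows "hilbert_adjoint (range_space H P) K (T \<circ> P) y = P (hilbert_adjoint H K T y)"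
proof -
  interpret R: hilbert_space "range_space H P" by (rule hilbert_space_range)
  show ?thesis
    using hilbert_adjoint[OF assms]
    by (intro R.hilbert_adjoint_eqI) (auto simp: P_mem P_sym)
qed

lemma opv_frame_range:
  assumes fd: "finite_dimensional H" and frame: "opv_frame H K V J"
  shows "opv_frame (range_space H P) K (\<lambda>j. V j \<circ> P) J"
proof -
  let ?S = "frame_operator H K V J" and ?R = "range_space H P"
  let ?S' = "frame_operator ?R K (\<lambda>j. V j \<circ> P) J"
  have K: "hilbert_space (K j)" "inner_product_space (K j)" and V: "bounded_operator H (K j) (V j)"
    if "j \<in> J" for j
    using frame that by (auto simp: opv_frame_def hilbert_space_def)
  have Vx: "V j x \<in> vecs (K j)" if "j \<in> J" "x \<in> vecs H" for j x
    using V[OF that(1)] that(2) by (auto simp: bounded_operator_def)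
  have adj: "hilbert_adjoint H (K j) (V j) (V j x) \<in> vecs H" if "j \<in> J" "x \<in> vecs H" for j x
    using hilbert_adjoint(1)[OF fd K(2) V Vx] that by blast
  have S: "?S x \<in> vecs H" if "x \<in> vecs H" for x
    using that adj by (auto simp: frame_operator_def subspace_vecs intro!: subspace_sum)
  have S': "?S' x = P (?S x)" if "x \<in> P ` vecs H" for x
  proof -
    have x: "x \<in> vecs H" "P x = x" using that by (auto simp: P_mem P_idem)
    show ?thesis
      using x by (simp add: frame_operator_def P_sum adj hilbert_adjoint_range[OF fd K(2) V Vx])
  qed
  \<comment> \<open>Scalar operators are their own compressions on the range, so
    \<open>operator_le_range\<close> yields both frame inequalities with the same \<open>A\<close>
    and \<open>B\<close>.\<close>
  have smul: "smul ?R c x = P (smul H c x)" if "x \<in> P ` vecs H" for c x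
    using that by (auto simp: P_mem P_idem P_smul)
  obtain A B where "A > 0" "B > 0" "operator_le H (smul H (of_real A)) ?S"
      "operator_le H ?S (smul H (of_real B))"
    using frame by (auto simp: opv_frame_def)
  moreover from this have "operator_le ?R (smul ?R (of_real A)) ?S'"
      "operator_le ?R ?S' (smul ?R (of_real B))"
    using S S' smul smul_mem by (blast intro: operator_le_range)+
  ultimately show ?thesis
    using frame K V hilbert_space_range bounded_operator_range unfolding opv_frame_def by blast
qed

end

theorem proposition15:
  fixes H :: "('k::real_or_complex, 'a::ab_group_add) hilb"
    and K :: "nat \<Rightarrow> ('k, 'b::ab_group_add) hilb"
    and V :: "nat \<Rightarrow> 'a \<Rightarrow> 'b"
    and P :: "'a \<Rightarrow> 'a"
    and m k :: nat
  assumes "hilbert_space H" and "finite_dimensional H"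
    and "\<And>j. j \<in> {1..m} \<Longrightarrow> hilbert_space (K j) \<and> finite_dimensional (K j)"
    and "\<And>j. j \<in> {1..m} \<Longrightarrow> bounded_operator H (K j) (V j)"
    and "opv_frame_robust H K V m k"
    and "orthogonal_projection H P"
  shows "opv_frame_robust (range_space H P) K (\<lambda>j. V j \<circ> P) m k"
proof -
  interpret projected_space H P
    using assms by (simp add: projected_space_def projected_space_axioms_def)
  show ?thesis
    \<comment> \<open>\<open>opv_frame_range\<close> holds for every index set, so it applies to
      \<open>{1..m}\<close> and to each \<open>{1..m} - I\<close> separately.\<close>
    using assms(5) opv_frame_range[OF assms(2)] by (auto simp: opv_frame_robust_def)
qed

end
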